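(* Let $f:\mathbb{R}^d\to\mathbb{R}$ be convex, differentiable, bounded below by $0$, and such that its infimum over $\mathbb{R}^d$ is not attained. Let $\boldsymbol{w}_0\in\mathbb{R}^d$, let $\eta>0$, and define gradient descent iterates by $\boldsymbol{w}_{t+1}=\boldsymbol{w}_t-\eta\nabla f(\boldsymbol{w}_t)$ for $t\ge0$. Suppose $\eta\le 1/(2f(\boldsymbol{w}_0))$ and $$f(\boldsymbol{w}_{t+1})-f(\boldsymbol{w}_t)\le-\frac{\eta}{2}\|\nabla f(\boldsymbol{w}_t)\|^2\quad\text{for all }t\ge0.$$ For $B>0$ let $\bar{\boldsymbol{w}}(B)=\arg\min_{\|\boldsymbol{w}\|\le B}f(\boldsymbol{w})$. If $\lim_{t\to\infty}\boldsymbol{w}_t/\|\boldsymbol{w}_t\|=\bar{\boldsymbol{u}}$ for some unit vector $\bar{\boldsymbol{u}}$, then also $\lim_{B\to\infty}\bar{\boldsymbol{w}}(B)/B=\bar{\boldsymbol{u}}$.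
   Context: $\|\cdot\|$ is the Euclidean norm. Since the infimum of $f$ is not attained, the minimizer $\bar{\boldsymbol{w}}(B)$ is unique. *)

theory Defs
  imports "HOL-Analysis.Analysis"
begin

definition gradient :: "('a::euclidean_space \<Rightarrow> real) \<Rightarrow> 'a \<Rightarrow> 'a" where
  "gradient f x = (THE D. GDERIV f x :> D)"

lemma gradient_eqI:
  assumes "GDERIV f x :> D"
  shows "gradient f x = D"
  unfolding gradient_def
proof (rule the_equality)
  show "GDERIV f x :> D" by (rule assms)
next
  fix E assume "GDERIV f x :> E"
  then have "(\<lambda>h. h \<bullet> E) = (\<lambda>h. h \<bullet> D)"
    using assms unfolding gderiv_def by (rule has_derivative_unique)
  then show "E = D" by (metis euclidean_eqI inner_commute)
qed

lemma GDERIV_gradient: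
  fixes f :: "'a::euclidean_space \<Rightarrow> real"
  assumes "f differentiable (at x)"
  shows "GDERIV f x :> gradient f x"
proof -
  obtain f' where f': "(f has_derivative f') (at x)"
    using assms unfolding differentiable_def by blast
  then have "linear f'" by (rule has_derivative_linear)
  then have "f' = (\<lambda>h. h \<bullet> adjoint f' 1)"
    by (simp add: fun_eq_iff adjoint_works)
  then have "GDERIV f x :> adjoint f' 1" using f' by (simp add: gderiv_def)
  then show ?thesis using gradient_eqI by metis
qed

definition ball_minimizer :: "('a::euclidean_space \<Rightarrow> real) \<Rightarrow> real \<Rightarrow> 'a" where
  "ball_minimizer f B = (ARG_MIN f w. norm w \<le> B)"

text \<open>The choice made by \<^const>\<open>arg_min\<close> is immaterial here: a continuous function has a
  minimizer on the ball, and for a convex function whose infimum is not attained it is unique.\<close>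

lemma is_arg_min_ball_minimizer:
  fixes f :: "'a::euclidean_space \<Rightarrow> real"
  assumes "continuous_on UNIV f" and "B \<ge> 0"
  shows "is_arg_min f (\<lambda>w. norm w \<le> B) (ball_minimizer f B)"
proof -
  have "continuous_on (cball 0 B) f" using assms(1) continuous_on_subset by blast
  then obtain x where "x \<in> cball 0 B" "\<forall>y\<in>cball 0 B. f x \<le> f y"
    using continuous_attains_inf[of "cball 0 B" f] assms(2) by auto
  then have "is_arg_min f (\<lambda>w. norm w \<le> B) x"
    by (simp add: is_arg_min_linorder)
  then show ?thesis unfolding ball_minimizer_def arg_min_def by (rule someI)
qed

lemma ball_minimizer_unique:
  fixes f :: "'a::euclidean_space \<Rightarrow> real"
  assumes cvx: "convex_on UNIV f"
    and not_attained: "\<not> (\<exists>z. f z = (INF x. f x))"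
    and x: "is_arg_min f (\<lambda>w. norm w \<le> B) x"
    and y: "is_arg_min f (\<lambda>w. norm w \<le> B) y"
  shows "x = y"
proof (rule ccontr)
  assume "x \<noteq> y"
  define m where "m = midpoint x y"
  have nx: "norm x \<le> B" and ny: "norm y \<le> B"
    using x y by (simp_all add: is_arg_min_linorder)
  have "norm m < B"
  proof -
    have "norm (x + y) ^ 2 + norm (x - y) ^ 2 = 2 * norm x ^ 2 + 2 * norm y ^ 2"
      by (simp add: power2_norm_eq_inner inner_add inner_diff)
    moreover have "0 < norm (x - y) ^ 2" using \<open>x \<noteq> y\<close> by simp
    moreover have "norm x ^ 2 \<le> B ^ 2" "norm y ^ 2 \<le> B ^ 2"
      using nx ny by (simp_all add: power_mono)
    ultimately have "norm (x + y) ^ 2 < 4 * B ^ 2" by linarith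
    then have "norm (x + y) ^ 2 < (2 * B) ^ 2" by (simp add: power_mult_distrib)
    moreover have "2 * B \<ge> 0" using nx norm_ge_zero[of x] by linarith
    ultimately have "norm (x + y) < 2 * B" by (rule power_less_imp_less_base)
    then show ?thesis by (simp add: m_def midpoint_def)
  qed
  have "f m \<le> (1/2) * f x + (1/2) * f y"
    using convex_onD[OF cvx, of "1/2" x y] by (simp add: m_def midpoint_def algebra_simps)
  then have fm: "f m \<le> f w" if "norm w \<le> B" for w
  proof -
    have "f x \<le> f w" "f y \<le> f w" using x y that by (simp_all add: is_arg_min_linorder)
    then show ?thesis using \<open>f m \<le> _\<close> by linarith
  qed
  have "\<forall>w\<in>ball m (B - norm m). f m \<le> f w"
  proof
    fix w assume "w \<in> ball m (B - norm m)"
    then have "norm (w - m) < B - norm m" by (simp add: dist_norm norm_minus_commute)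
    then have "norm w \<le> B" using norm_triangle_sub[of w m] by linarith
    then show "f m \<le> f w" by (rule fm)
  qed
  then have "\<forall>w\<in>UNIV. f m \<le> f w"
    using convex_local_global_minimum[OF _ cvx, of "B - norm m" m] \<open>norm m < B\<close> by auto
  then have "(INF x. f x) = f m"
    by (intro cInf_eq_minimum) auto
  then show False using not_attained by metis
qed

end

theory Submission
  imports Defs
begin

text \<open>Expanding the square shows that a descent step brings the iterate closer to every point \<open>z\<close>
  whose value is at most that of the next iterate, so the values \<open>f (w t)\<close> eventually drop below
  that of \<open>z = ball_minimizer f B\<close>. Just before this happens the iterate \<open>w t\<close> has norm at least
  \<open>B - 1\<close>, because the steps have length at most 1. Fix \<open>\<delta> > 0\<close> and let \<open>w s\<close> be the first iterate of
  norm at least \<open>(1 - \<delta>) * B\<close>. Then \<open>w t\<close> is at least as close to \<open>z\<close> as \<open>w s\<close>, while both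
  are nearly multiples of \<open>u\<close>. Writing \<open>r\<close> and \<open>\<rho>\<close> for the norms of \<open>w t\<close> and \<open>w s\<close>, this says
  \<open>r\<^sup>2 - \<rho>\<^sup>2 \<le> 2 * (r - \<rho>) * (u \<bullet> z)\<close> up to a small error, and division by \<open>r - \<rho>\<close> bounds
  \<open>u \<bullet> z\<close> below by nearly \<open>B\<close>.\<close>

text \<open>Restricting \<open>f\<close> to the line through \<open>x\<close> and \<open>y\<close>
  reduces the claim to the tangent inequality for convex functions of one real variable.\<close>

lemma convex_on_above_gradient:
  fixes f :: "'a::real_inner \<Rightarrow> real"
  assumes "convex_on UNIV f" and "GDERIV f x :> D"
  shows "f x + (y - x) \<bullet> D \<le> f y"
proof -
  define g where "g = (\<lambda>t. f (x + t *\<^sub>R (y - x)))"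
  have "convex_on UNIV g"
  proof (rule convex_onI)
    fix t a b :: real
    assume "0 < t" "t < 1"
    have "x + ((1 - t) *\<^sub>R a + t *\<^sub>R b) *\<^sub>R (y - x)
        = (1 - t) *\<^sub>R (x + a *\<^sub>R (y - x)) + t *\<^sub>R (x + b *\<^sub>R (y - x))"
      by (simp add: algebra_simps)
    then show "g ((1 - t) *\<^sub>R a + t *\<^sub>R b) \<le> (1 - t) * g a + t * g b"
      using convex_onD[OF assms(1), of t] \<open>0 < t\<close> \<open>t < 1\<close> unfolding g_def by simp
  qed simp
  moreover have "(g has_field_derivative (y - x) \<bullet> D) (at 0)"
  proof -
    have f: "(f has_derivative (\<lambda>h. h \<bullet> D)) (at (x + 0 *\<^sub>R (y - x)))"
      using assms(2) by (simp add: gderiv_def)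
    have "((\<lambda>t. x + t *\<^sub>R (y - x)) has_derivative (\<lambda>t. t *\<^sub>R (y - x))) (at 0)"
      by (auto intro!: derivative_eq_intros)
    from has_derivative_compose[OF this f] show ?thesis
      by (simp add: g_def has_field_derivative_def mult_commute_abs)
  qed
  ultimately have "g 1 - g 0 \<ge> ((y - x) \<bullet> D) * (1 - 0)"
    using convex_on_imp_above_tangent[of UNIV g 0 1] by simp
  then show ?thesis by (simp add: g_def)
qed

text \<open>In the expanded square, convexity bounds the linear term by
  \<open>2 * \<eta> * (f z - f x)\<close>. The descent condition bounds the quadratic term by
  \<open>2 * \<eta> * (f x - f x')\<close>, so \<open>f x\<close> cancels and only the new value
  \<open>f x'\<close> remains.\<close>

lemma gradient_step_dist:
  fixes f :: "'a::real_inner \<Rightarrow> real"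
  assumes "convex_on UNIV f" and "GDERIV f x :> D" and "\<eta> > 0"
    and x': "x' = x - \<eta> *\<^sub>R D"
    and desc: "f x' - f x \<le> - (\<eta> / 2) * (norm D)\<^sup>2"
  shows "(norm (x' - z))\<^sup>2 \<le> (norm (x - z))\<^sup>2 - 2 * \<eta> * (f x' - f z)"
proof -
  have "(norm (x' - z))\<^sup>2 = (norm (x - z))\<^sup>2 + 2 * \<eta> * ((z - x) \<bullet> D) + \<eta> * (\<eta> * (norm D)\<^sup>2)"
    by (simp add: x' power2_norm_eq_inner inner_diff inner_commute algebra_simps)
  moreover have "\<eta> * ((z - x) \<bullet> D) \<le> \<eta> * (f z - f x)"
    using convex_on_above_gradient[OF assms(1,2), of z] \<open>\<eta> > 0\<close> by (intro mult_left_mono) auto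
  moreover have "\<eta> * (\<eta> * (norm D)\<^sup>2) \<le> \<eta> * (2 * (f x - f x'))"
    using desc \<open>\<eta> > 0\<close> by (intro mult_left_mono) auto
  ultimately show ?thesis by (simp add: algebra_simps)
qed

text \<open>Here \<open>a\<close> and \<open>b\<close> stand for consecutive function values. The
  squared step length is at most \<open>2 * \<eta> * (a - b)\<close>, hence at most
  \<open>2 * \<eta> * a\<close>.\<close>

lemma gradient_step_length:
  fixes D :: "'a::real_normed_vector"
  assumes "\<eta> > 0" and "0 \<le> b" and "2 * \<eta> * a \<le> 1"
    and "b - a \<le> - (\<eta> / 2) * (norm D)\<^sup>2"
  shows "norm (\<eta> *\<^sub>R D) \<le> 1"
proof -
  have "(norm (\<eta> *\<^sub>R D))\<^sup>2 = 2 * \<eta> * ((\<eta> / 2) * (norm D)\<^sup>2)"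
    by (simp add: power2_eq_square)
  also have "\<dots> \<le> 2 * \<eta> * a"
    using assms by (intro mult_left_mono) auto
  also have "\<dots> \<le> 1" by fact
  finally show ?thesis by (simp add: power_le_one_iff)
qed

text \<open>To be used with \<open>p = w t\<close>, \<open>q = w s\<close> and \<open>z\<close> the
  minimizer. The angular error is quadratic in \<open>\<delta>\<close> because the gap between the
  two norms is only of order \<open>\<delta> * B\<close>: after division by the gap, an error of
  order \<open>\<delta>\<close> is left.\<close>

lemma le_norm_diff_inner_bound:
  fixes u z p q :: "'a::real_inner"
  assumes "0 < \<delta>" "\<delta> < 1" and B: "4 / \<delta> \<le> B" and "norm z \<le> B"
    and closer: "norm (p - z) \<le> norm (q - z)"
    and p: "norm (p - norm p *\<^sub>R u) \<le> \<delta>\<^sup>2 / 4 * norm p"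
    and q: "norm (q - norm q *\<^sub>R u) \<le> \<delta>\<^sup>2 / 4 * norm q"
    and np: "B - 1 \<le> norm p" and nq: "(1 - \<delta>) * B \<le> norm q" "norm q \<le> (1 - \<delta>) * B + 1"
  shows "(1 - 2 * \<delta>) * B \<le> u \<bullet> z"
proof -
  define r \<rho> c where "r = norm p" and "\<rho> = norm q" and "c = u \<bullet> z"
  have dB: "4 \<le> \<delta> * B" using B \<open>0 < \<delta>\<close> by (simp add: field_simps)
  have "B > 0" using B \<open>0 < \<delta>\<close> by (smt (verit) divide_pos_pos)
  have pz: "p \<bullet> z \<le> r * c + \<delta>\<^sup>2 / 4 * r * B"
  proof -
    have "p \<bullet> z - r * c = (p - r *\<^sub>R u) \<bullet> z" by (simp add: c_def inner_diff)
    also have "\<dots> \<le> norm (p - r *\<^sub>R u) * norm z" by (rule norm_cauchy_schwarz)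
    also have "\<dots> \<le> (\<delta>\<^sup>2 / 4 * r) * B"
      using p \<open>norm z \<le> B\<close> by (intro mult_mono) (auto simp: r_def)
    finally show ?thesis by simp
  qed
  have qz: "\<rho> * c - \<delta>\<^sup>2 / 4 * \<rho> * B \<le> q \<bullet> z"
  proof -
    have "\<rho> * c - q \<bullet> z = (q - \<rho> *\<^sub>R u) \<bullet> (- z)" by (simp add: c_def inner_diff)
    also have "\<dots> \<le> norm (q - \<rho> *\<^sub>R u) * norm (- z)" by (rule norm_cauchy_schwarz)
    also have "\<dots> \<le> (\<delta>\<^sup>2 / 4 * \<rho>) * B"
      using q \<open>norm z \<le> B\<close> by (intro mult_mono) (auto simp: \<rho>_def)
    finally show ?thesis by simp
  qed
  have "(norm (p - z))\<^sup>2 \<le> (norm (q - z))\<^sup>2"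
    using closer by (simp add: power_mono)
  then have "r\<^sup>2 - 2 * (p \<bullet> z) \<le> \<rho>\<^sup>2 - 2 * (q \<bullet> z)"
    by (simp add: r_def \<rho>_def power2_norm_eq_inner inner_diff inner_commute)
  then have "r\<^sup>2 - \<rho>\<^sup>2 \<le> 2 * (r - \<rho>) * c + \<delta>\<^sup>2 / 2 * (r + \<rho>) * B"
    using pz qz by (simp add: algebra_simps add_divide_distrib)
  then have main: "(r + \<rho>) * ((r - \<rho>) - \<delta>\<^sup>2 / 2 * B) \<le> 2 * (r - \<rho>) * c"
    by (simp add: algebra_simps power2_eq_square)
  \<comment> \<open>The norm bounds give \<open>r - \<rho> \<ge> \<delta> * B - 2\<close>; the
    condition \<open>4 / \<delta> \<le> B\<close> serves to absorb the 2.\<close>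
  have gap: "\<delta> * B / 2 \<le> r - \<rho>"
    using np nq dB by (simp add: r_def \<rho>_def algebra_simps)
  then have "0 < r - \<rho>" using dB by linarith
  have "\<delta>\<^sup>2 / 2 * B \<le> \<delta> * (r - \<rho>)"
    using mult_left_mono[OF gap, of \<delta>] \<open>0 < \<delta>\<close> by (simp add: power2_eq_square)
  then have "(1 - \<delta>) * (r - \<rho>) \<le> (r - \<rho>) - \<delta>\<^sup>2 / 2 * B"
    by (simp add: algebra_simps)
  moreover have sum: "2 * (1 - \<delta>) * B \<le> r + \<rho>"
    using np nq dB by (simp add: r_def \<rho>_def algebra_simps)
  ultimately have "(2 * (1 - \<delta>) * B) * ((1 - \<delta>) * (r - \<rho>)) \<le> 2 * (r - \<rho>) * c"
    using main \<open>0 < r - \<rho>\<close> \<open>\<delta> < 1\<close>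
    by (smt (verit) mult_mono mult_nonneg_nonneg r_def \<rho>_def norm_ge_zero)
  then have "(1 - \<delta>) * (1 - \<delta>) * B * (2 * (r - \<rho>)) \<le> c * (2 * (r - \<rho>))"
    by (simp add: algebra_simps)
  then have "(1 - \<delta>) * (1 - \<delta>) * B \<le> c"
    by (rule mult_right_le_imp_le) (use \<open>0 < r - \<rho>\<close> in simp)
  moreover have "(1 - 2 * \<delta>) * B \<le> (1 - \<delta>) * (1 - \<delta>) * B"
    using \<open>B > 0\<close> by (intro mult_right_mono) (auto simp: algebra_simps)
  ultimately show ?thesis by (simp add: c_def)
qed

theorem theorem4:
  fixes f :: "real ^ 'n \<Rightarrow> real"
    and w :: "nat \<Rightarrow> real ^ 'n"
    and \<eta> :: real
    and u :: "real ^ 'n"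
  assumes "convex_on UNIV f"
    and "\<And>x. f differentiable (at x)"
    and "\<And>x. 0 \<le> f x"
    and "\<not> (\<exists>z. f z = (INF x. f x))"
    and "\<eta> > 0"
    and "\<And>t. w (Suc t) = w t - \<eta> *\<^sub>R gradient f (w t)"
    and "\<eta> \<le> 1 / (2 * f (w 0))"
    and "\<And>t. f (w (Suc t)) - f (w t) \<le> - (\<eta> / 2) * (norm (gradient f (w t)))\<^sup>2"
    and "norm u = 1"
    and "(\<lambda>t. w t /\<^sub>R norm (w t)) \<longlonglongrightarrow> u"
  shows "((\<lambda>B. ball_minimizer f B /\<^sub>R B) \<longlongrightarrow> u) at_top"
proof -
  have fejer: "(norm (w (Suc t) - z))\<^sup>2 \<le> (norm (w t - z))\<^sup>2 - 2 * \<eta> * (f (w (Suc t)) - f z)" for t z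
    using gradient_step_dist[OF assms(1) GDERIV_gradient[OF assms(2)] assms(5,6,8)] .
  have "f (w (Suc t)) \<le> f (w t)" for t
    using assms(8)[of t] mult_nonneg_nonneg[of "\<eta> / 2" "(norm (gradient f (w t)))\<^sup>2"] assms(5)
    by (smt (verit) mult_minus_left zero_le_power2 half_gt_zero)
  then have "decseq (\<lambda>t. f (w t))" by (simp add: decseq_Suc_iff)
  then have f_le: "f (w t) \<le> f (w 0)" for t by (simp add: decseq_def)
  \<comment> \<open>If \<open>f (w 0)\<close> were 0, the bound on \<open>\<eta>\<close> would read
    \<open>\<eta> \<le> 0\<close>, since division by zero yields 0.\<close>
  have "f (w 0) \<noteq> 0" using assms(5,7) by auto
  then have "f (w 0) > 0" using assms(3)[of "w 0"] by linarith
  then have "2 * \<eta> * f (w 0) \<le> 1" using assms(7) by (simp add: field_simps)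
  then have small: "2 * \<eta> * f (w t) \<le> 1" for t
    using mult_left_mono[OF f_le[of t], of "2 * \<eta>"] assms(5) by linarith
  have len: "norm (w (Suc t)) \<le> norm (w t) + 1" for t
    using gradient_step_length[OF assms(5) assms(3) small assms(8), of t]
      norm_triangle_ineq4[of "w t" "\<eta> *\<^sub>R gradient f (w t)"]
    by (simp add: assms(6))
  \<comment> \<open>Otherwise, for any \<open>y\<close> with \<open>f y < f z\<close>, each step
    would lower the squared distance to \<open>y\<close> by at least a fixed positive
    amount.\<close>
  have below: "\<exists>T. f (w T) < f z" for z
  proof (rule ccontr)
    assume "\<not> ?thesis"
    then have ge: "f z \<le> f (w t)" for t by (simp add: not_less)
    obtain y where "f y < f z"
    proof -
      have "bdd_below (range f)" using assms(3) by (auto intro: bdd_belowI[of _ 0])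
      then have "(INF x. f x) < f z"
        using assms(4) cINF_lower[of f UNIV z] by (metis UNIV_I order_less_le)
      then show ?thesis using that cINF_less_iff[OF _ \<open>bdd_below (range f)\<close>] by auto
    qed
    define e where "e = 2 * \<eta> * (f z - f y)"
    have "e > 0" using assms(5) \<open>f y < f z\<close> by (simp add: e_def)
    have "(norm (w t - y))\<^sup>2 \<le> (norm (w 0 - y))\<^sup>2 - of_nat t * e" for t
    proof (induction t)
      case (Suc t)
      have "e \<le> 2 * \<eta> * (f (w (Suc t)) - f y)"
        using ge[of "Suc t"] assms(5) by (simp add: e_def)
      then show ?case using Suc fejer[of t y] by (simp add: algebra_simps)
    qed simp
    then have "of_nat t * e \<le> (norm (w 0 - y))\<^sup>2" for t :: nat
      by (smt (verit) zero_le_power2)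
    then show False using reals_Archimedean3[OF \<open>e > 0\<close>] by (meson not_less)
  qed
  have "continuous_on UNIV f"
    using assms(2) by (auto intro: differentiable_imp_continuous_within
        simp: continuous_on_eq_continuous_within)
  then have min: "norm (ball_minimizer f B) \<le> B"
      "\<And>x. norm x \<le> B \<Longrightarrow> f (ball_minimizer f B) \<le> f x" if "B \<ge> 0" for B
    using is_arg_min_ball_minimizer[OF _ that] by (auto simp: is_arg_min_linorder)
  have inner: "\<forall>\<^sub>F B in at_top. (1 - 2 * \<delta>) * B \<le> u \<bullet> ball_minimizer f B"
    if \<delta>: "0 < \<delta>" "\<delta> < 1" for \<delta>
  proof -
    obtain N where N: "norm (w n /\<^sub>R norm (w n) - u) < \<delta>\<^sup>2 / 4" if "n \<ge> N" for n
      using LIMSEQ_D[OF assms(10), of "\<delta>\<^sup>2 / 4"] \<delta> by auto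
    have dir: "norm (w n - norm (w n) *\<^sub>R u) \<le> \<delta>\<^sup>2 / 4 * norm (w n)" if "n \<ge> N" for n
    proof -
      have "w n - norm (w n) *\<^sub>R u = norm (w n) *\<^sub>R (w n /\<^sub>R norm (w n) - u)"
        by (cases "w n = 0") (simp_all add: scaleR_diff_right)
      then have "norm (w n - norm (w n) *\<^sub>R u) = norm (w n) * norm (w n /\<^sub>R norm (w n) - u)"
        by simp
      then show ?thesis using mult_left_mono[OF less_imp_le[OF N[OF that]], of "norm (w n)"]
        by (simp add: mult.commute)
    qed
    \<comment> \<open>Once \<open>(1 - \<delta>) * B\<close> exceeds \<open>M\<close>, an iterate of
      that norm has index beyond \<open>N\<close>, where directions are already close to
      \<open>u\<close>.\<close>
    define M where "M = Max ((\<lambda>i. norm (w i)) ` {..N})"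
    have M: "norm (w i) \<le> M" if "i \<le> N" for i
      unfolding M_def using that by (intro Max_ge) auto
    have "(1 - 2 * \<delta>) * B \<le> u \<bullet> ball_minimizer f B"
      if B: "4 / \<delta> \<le> B" "M / (1 - \<delta>) < B" for B
    proof -
      define z where "z = ball_minimizer f B"
      have "B > 0" using B(1) \<delta> by (smt (verit) divide_pos_pos)
      have z: "norm z \<le> B" "\<And>x. norm x \<le> B \<Longrightarrow> f z \<le> f x"
        using min \<open>B > 0\<close> by (auto simp: z_def)
      have MB: "M < (1 - \<delta>) * B" using B(2) \<delta> by (simp add: field_simps)
      have low: "(1 - \<delta>) * B \<le> B - 1" using B(1) \<delta> by (simp add: field_simps)
      define T where "T = (LEAST T. f (w T) < f z)"
      have T: "f (w T) < f z" unfolding T_def using below by (rule LeastI_ex)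
      have before: "f z \<le> f (w i)" if "i < T" for i
        using that not_less_Least unfolding T_def by (metis not_less)
      have "B < norm (w T)" using z(2)[of "w T"] T by linarith
      \<comment> \<open>The start lies inside the ball and \<open>w T\<close> outside, so
        \<open>T\<close> has a predecessor.\<close>
      moreover have "norm (w 0) < B" using M[of 0] MB low by simp
      ultimately obtain t where t: "T = Suc t" by (cases T) auto
      have nt: "B - 1 \<le> norm (w t)" using \<open>B < norm (w T)\<close> len[of t] t by simp
      define s where "s = (LEAST s. (1 - \<delta>) * B \<le> norm (w s))"
      have "(1 - \<delta>) * B \<le> norm (w t)" using low nt by linarith
      then have s: "(1 - \<delta>) * B \<le> norm (w s)" "s \<le> t"
        unfolding s_def by (auto intro: LeastI Least_le)
      have "N \<le> s" using M[of s] s(1) MB by linarith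
      have "norm (w s) \<le> (1 - \<delta>) * B + 1"
      proof (cases s)
        case 0
        then show ?thesis using M[of 0] MB by simp
      next
        case (Suc k)
        then have "norm (w k) < (1 - \<delta>) * B"
          using not_less_Least[of k "\<lambda>s. (1 - \<delta>) * B \<le> norm (w s)"] unfolding s_def by linarith
        then show ?thesis using len[of k] Suc by simp
      qed
      \<comment> \<open>Downward induction from \<open>t\<close> to \<open>s\<close>: each step
        taken ends at an index at most \<open>t\<close>, hence before \<open>T\<close>, where the
        value is still at least \<open>f z\<close>.\<close>
      moreover have "norm (w t - z) \<le> norm (w s - z)"
        using s(2) order_refl[of t]
      proof (induction rule: inc_induct)
        case (step n)
        have "f z \<le> f (w (Suc n))" using before t step by simp
        then have "0 \<le> 2 * \<eta> * (f (w (Suc n)) - f z)" using assms(5) by simp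
        then have "(norm (w (Suc n) - z))\<^sup>2 \<le> (norm (w n - z))\<^sup>2"
          using fejer[of n z] by linarith
        then show ?case using step by (simp add: power2_le_iff_abs_le)
      qed simp
      ultimately show ?thesis
        using le_norm_diff_inner_bound[OF \<delta> B(1) z(1) _ dir dir nt s(1)] \<open>N \<le> s\<close> s(2)
        by (simp add: z_def)
    qed
    then show ?thesis
      by (intro eventually_mono[OF eventually_conj[OF eventually_ge_at_top[of "4 / \<delta>"]
            eventually_gt_at_top[of "M / (1 - \<delta>)"]]]) auto
  qed
  show ?thesis
  proof (rule tendstoI)
    fix e :: real assume "e > 0"
    \<comment> \<open>For \<open>v\<close> of norm at most 1 with
      \<open>u \<bullet> v \<ge> 1 - 2 * \<delta>\<close>, the squared distance to \<open>u\<close>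
      is at most \<open>4 * \<delta>\<close>, which must stay below the square of
      \<open>e\<close>.\<close>
    define \<delta> where "\<delta> = min (1 / 2) (e\<^sup>2 / 8)"
    have \<delta>: "0 < \<delta>" "\<delta> < 1" "4 * \<delta> < e\<^sup>2" using \<open>e > 0\<close> by (auto simp: \<delta>_def min_def)
    show "\<forall>\<^sub>F B in at_top. dist (ball_minimizer f B /\<^sub>R B) u < e"
      using inner[OF \<delta>(1,2)] eventually_gt_at_top[of 0]
    proof eventually_elim
      case (elim B)
      define v where "v = ball_minimizer f B /\<^sub>R B"
      have "norm v \<le> 1" using min(1)[of B] elim(2) by (simp add: v_def field_simps)
      then have "(norm v)\<^sup>2 \<le> 1" by (simp add: power_le_one)
      moreover have "1 - 2 * \<delta> \<le> u \<bullet> v" using elim by (simp add: v_def field_simps)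
      moreover have "(norm (v - u))\<^sup>2 = (norm v)\<^sup>2 + 1 - 2 * (u \<bullet> v)"
        using assms(9) by (simp add: power2_norm_eq_inner inner_diff inner_commute norm_eq_1)
      ultimately have "(norm (v - u))\<^sup>2 < e\<^sup>2" using \<delta>(3) by linarith
      then show ?case
        using \<open>e > 0\<close> by (simp add: v_def dist_norm power2_less_imp_less)
    qed
  qed
qed

end
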